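(* Without loss of generality let $N$ be even, and consider the ($d$-dimensional, $d\ge1$) chain of harmonic oscillators on $[N]^d=\{1,\dots,N\}^d$ with equal masses and unit coupling (interaction) strength $\xi_{i,j}=1$. In addition, assume that there is always at least one particle experiencing friction at the boundary $\partial[N]^d$ and that the friction of the particles is bounded uniformly in $N$. Let $c_d(N)=(N/2,\dots,N/2)$ be the centre point and assume that for some $\varepsilon>0$ $$\eta_{c_d(N)}+2d+\varepsilon\le\eta_i\qquad\text{uniformly in }[N]^d,\quad i\ne c_d(N).$$ Then the spectral gap $\lambda_S$ of the harmonic chain of oscillators with this impurity decays exponentially fast in $N$.
   Context: Setting: each site $i\in[N]^d$ carries a particle with mass $m_i>0$ and pinning strength $\eta_i>0$; nearest neighbors $i\sim j$ in $\mathbb Z^d$ interact with strength $\xi_{i,j}>0$. $I\subset[N]^d$ is the set of particles subject to friction, with friction parameters $\gamma_i>0$, $i\in I$. The boundary is $\partial[N]^d=\{i\in[N]^d:\exists n,\ i_n=1\text{ or }i_n=N\}$. Let $B_{[N]^d}$ be the self-adjoint matrix (discrete Schrödinger operator) on $\mathbb C^{[N]^d}$ with quadratic form $\langle u,B_{[N]^d}u\rangle=\sum_{i\sim j}\xi_{i,j}|u(i)-u(j)|^2+\sum_i\eta_i|u(i)|^2$ (first sum over unordered nearest-neighbor pairs), $\mathbf m=\operatorname{diag}(m_i)$, $\Gamma=\operatorname{diag}(\gamma_i\delta_{i\in I})$, where $\delta_{i\in I}=1$ if $i\in I$ and $0$ otherwise, and $$M_{[N]^d}=\begin{pmatrix}\Gamma&-\mathbf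 m^{-1}\\ B_{[N]^d}&0\end{pmatrix}.$$ The dynamics is the Ornstein–Uhlenbeck process with generator $\mathcal Lf(z)=-zM_{[N]^d}\cdot\nabla_zf(z)+\nabla_p\cdot\Gamma\mathbf m\Theta\nabla_pf(z)$, $z=(p,q)$, where $\Theta=\operatorname{diag}(\beta_i^{-1}\delta_{i\in I})$ contains the bath temperatures. The spectral gap of the generator is $\lambda_S:=\inf\{\operatorname{Re}(\lambda):\lambda\in\operatorname{Spec}(M_{[N]^d})\}$.
   Formalization: All particles experiencing friction are assumed to lie on the boundary (a nonempty subset of it), not merely at least one; if every particle has friction 1 and mass 1, and the centre has pinning 1, the spectral gap is 1/2 for all N, so the literal claim fails. *)

theory Defs
  imports Complex_Main "HOL-Library.FuncSet" "HOL-Library.Countable_Set"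
    "Jordan_Normal_Form.Matrix" "Jordan_Normal_Form.Spectral_Radius"
begin

text \<open>Sites are coordinate functions on \<open>{..<d}\<close> (so coordinates are numbered from 0), with
  coordinate values in \<open>{1..N}\<close>; extensionality makes the box finite with \<open>N ^ d\<close> elements.\<close>

type_synonym site = "nat \<Rightarrow> nat"

definition site_box :: "nat \<Rightarrow> nat \<Rightarrow> site set" where
  "site_box d N = ({..<d} \<rightarrow>\<^sub>E {1..N})"

definition site_box_boundary :: "nat \<Rightarrow> nat \<Rightarrow> site set" where
  "site_box_boundary d N = {i \<in> site_box d N. \<exists>n<d. i n = 1 \<or> i n = N}"

definition site_box_center :: "nat \<Rightarrow> nat \<Rightarrow> site" where
  "site_box_center d N = (\<lambda>n\<in>{..<d}. N div 2)"

definition nearest_neighbor :: "nat \<Rightarrow> site \<Rightarrow> site \<Rightarrow> bool" where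
  "nearest_neighbor d i j \<longleftrightarrow> (\<Sum>n<d. \<bar>int (i n) - int (j n)\<bar>) = 1"

text \<open>Matrices indexed by sites are turned into library matrices through the library's enumeration
  of the finite set \<open>site_box d N\<close> by \<open>{..<card (site_box d N)}\<close>; all blocks use the same enumeration, so the
  spectrum below does not depend on it.\<close>

definition site_mat :: "nat \<Rightarrow> nat \<Rightarrow> (site \<Rightarrow> site \<Rightarrow> complex) \<Rightarrow> complex mat" where
  "site_mat d N K = mat (card (site_box d N)) (card (site_box d N))
     (\<lambda>(a, b). K (from_nat_into (site_box d N) a) (from_nat_into (site_box d N) b))"

definition site_diag_mat :: "nat \<Rightarrow> nat \<Rightarrow> (site \<Rightarrow> real) \<Rightarrow> complex mat" where
  "site_diag_mat d N f = site_mat d N (\<lambda>i j. if i = j then complex_of_real (f i) else 0)"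

text \<open>Entries of the self-adjoint matrix whose quadratic form is
  \<open>\<Sum>\<^bsub>i \<sim> j\<^esub> \<xi>\<^bsub>i,j\<^esub> |u(i) - u(j)|\<^sup>2 + \<Sum>\<^bsub>i\<^esub> \<eta>\<^bsub>i\<^esub> |u(i)|\<^sup>2\<close>, the first sum being over unordered pairs of
  nearest neighbors inside the box; see \<open>schroedinger_entry_quadratic_form\<close>.\<close>

definition schroedinger_entry ::
    "nat \<Rightarrow> nat \<Rightarrow> (site \<Rightarrow> site \<Rightarrow> real) \<Rightarrow> (site \<Rightarrow> real) \<Rightarrow> site \<Rightarrow> site \<Rightarrow> real" where
  "schroedinger_entry d N \<xi> \<eta> i j =
     (if i = j then (\<Sum>k | k \<in> site_box d N \<and> nearest_neighbor d i k. \<xi> i k) + \<eta> i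
      else if nearest_neighbor d i j then - \<xi> i j else 0)"

definition schroedinger_mat ::
    "nat \<Rightarrow> nat \<Rightarrow> (site \<Rightarrow> site \<Rightarrow> real) \<Rightarrow> (site \<Rightarrow> real) \<Rightarrow> complex mat" where
  "schroedinger_mat d N \<xi> \<eta> =
     site_mat d N (\<lambda>i j. complex_of_real (schroedinger_entry d N \<xi> \<eta> i j))"

text \<open>\<open>m\<close> are the masses, \<open>\<xi>\<close> the interaction strengths, \<open>\<eta>\<close> the pinning strengths, \<open>I\<close> the set of
  particles subject to friction and \<open>\<gamma>\<close> the friction parameters.\<close>

definition network_mat ::
    "nat \<Rightarrow> nat \<Rightarrow> (site \<Rightarrow> real) \<Rightarrow> (site \<Rightarrow> site \<Rightarrow> real) \<Rightarrow> (site \<Rightarrow> real) \<Rightarrow> site set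
      \<Rightarrow> (site \<Rightarrow> real) \<Rightarrow> complex mat" where
  "network_mat d N m \<xi> \<eta> I \<gamma> =
     four_block_mat
       (site_diag_mat d N (\<lambda>i. if i \<in> I then \<gamma> i else 0)) (- site_diag_mat d N (\<lambda>i. 1 / m i))
       (schroedinger_mat d N \<xi> \<eta>) (0\<^sub>m (card (site_box d N)) (card (site_box d N)))"

definition spectral_gap ::
    "nat \<Rightarrow> nat \<Rightarrow> (site \<Rightarrow> real) \<Rightarrow> (site \<Rightarrow> site \<Rightarrow> real) \<Rightarrow> (site \<Rightarrow> real) \<Rightarrow> site set
      \<Rightarrow> (site \<Rightarrow> real) \<Rightarrow> real" where
  "spectral_gap d N m \<xi> \<eta> I \<gamma> = Inf (Re ` spectrum (network_mat d N m \<xi> \<eta> I \<gamma>))"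

lemma finite_site_box: "finite (site_box d N)"
  unfolding site_box_def by (intro finite_PiE) auto

lemma card_site_box: "card (site_box d N) = N ^ d"
  unfolding site_box_def by (simp add: card_PiE)

lemma bij_betw_site_enumeration:
  "bij_betw (from_nat_into (site_box d N)) {..<card (site_box d N)} (site_box d N)"
  using finite_site_box by (rule bij_betw_from_nat_into_finite)

lemma nearest_neighbor_sym: "nearest_neighbor d i j \<longleftrightarrow> nearest_neighbor d j i"
  unfolding nearest_neighbor_def by (simp add: abs_minus_commute)

lemma not_nearest_neighbor_self: "\<not> nearest_neighbor d i i"
  unfolding nearest_neighbor_def by simp

lemma schroedinger_entry_sym:
  assumes "\<And>i j. \<xi> i j = \<xi> j i"
  shows "schroedinger_entry d N \<xi> \<eta> i j = schroedinger_entry d N \<xi> \<eta> j i"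
  by (cases "i = j") (simp_all add: schroedinger_entry_def nearest_neighbor_sym[of d i j] assms[of i j])

text \<open>The factor \<open>1/2\<close> turns the sum over ordered pairs into one over unordered pairs.\<close>

lemma schroedinger_entry_quadratic_form:
  fixes u :: "site \<Rightarrow> complex"
  assumes sym: "\<And>i j. \<xi> i j = \<xi> j i"
  shows "(\<Sum>i\<in>site_box d N. \<Sum>j\<in>site_box d N.
            cnj (u i) * complex_of_real (schroedinger_entry d N \<xi> \<eta> i j) * u j)
       = complex_of_real
           (1 / 2 * (\<Sum>i\<in>site_box d N. \<Sum>j | j \<in> site_box d N \<and> nearest_neighbor d i j.
                       \<xi> i j * (cmod (u i - u j))\<^sup>2)
            + (\<Sum>i\<in>site_box d N. \<eta> i * (cmod (u i))\<^sup>2))"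
proof -
  let ?B = "site_box d N"
  define w where "w i j = (if nearest_neighbor d i j then complex_of_real (\<xi> i j) else 0)" for i j
  have w_sym: "w i j = w j i" for i j
    by (simp add: w_def nearest_neighbor_sym[of d i j] sym[of i j])
  have nb: "(\<Sum>j | j \<in> ?B \<and> nearest_neighbor d i j. f j) =
      (\<Sum>j\<in>?B. if nearest_neighbor d i j then f j else 0)" for i and f :: "site \<Rightarrow> 'b::comm_monoid_add"
    using sum.inter_filter[OF finite_site_box] by blast
  have entry: "complex_of_real (schroedinger_entry d N \<xi> \<eta> i j) =
      (if j = i then (\<Sum>k\<in>?B. w i k) + of_real (\<eta> i) else 0) - w i j" for i j
    by (auto simp: schroedinger_entry_def nb w_def not_nearest_neighbor_self intro!: sum.cong)
  define S where "S = (\<Sum>i\<in>?B. \<Sum>k\<in>?B. w i k * (cnj (u i) * u i))"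
  define T where "T = (\<Sum>i\<in>?B. \<Sum>k\<in>?B. w i k * (cnj (u i) * u k))"
  define H where "H = (\<Sum>i\<in>?B. of_real (\<eta> i) * (cnj (u i) * u i))"
  have row: "(\<Sum>j\<in>?B. cnj (u i) * complex_of_real (schroedinger_entry d N \<xi> \<eta> i j) * u j) =
      (\<Sum>k\<in>?B. w i k * (cnj (u i) * u i)) + of_real (\<eta> i) * (cnj (u i) * u i)
      - (\<Sum>k\<in>?B. w i k * (cnj (u i) * u k))" if "i \<in> ?B" for i
  proof -
    have "(\<Sum>j\<in>?B. cnj (u i) * complex_of_real (schroedinger_entry d N \<xi> \<eta> i j) * u j) =
      (\<Sum>j\<in>?B. (if j = i then cnj (u i) * ((\<Sum>k\<in>?B. w i k) + of_real (\<eta> i)) * u i else 0)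
         - w i j * (cnj (u i) * u j))"
      unfolding entry by (intro sum.cong) (auto simp: algebra_simps)
    also have "\<dots> = cnj (u i) * ((\<Sum>k\<in>?B. w i k) + of_real (\<eta> i)) * u i
         - (\<Sum>j\<in>?B. w i j * (cnj (u i) * u j))"
      using that by (simp add: sum_subtractf finite_site_box)
    finally show ?thesis
      by (simp add: algebra_simps sum_distrib_left sum_distrib_right)
  qed
  have lhs: "(\<Sum>i\<in>?B. \<Sum>j\<in>?B.
      cnj (u i) * complex_of_real (schroedinger_entry d N \<xi> \<eta> i j) * u j) = S + H - T"
    unfolding S_def T_def H_def using row by (simp add: sum_subtractf sum.distrib)
  have swapS: "(\<Sum>i\<in>?B. \<Sum>k\<in>?B. w i k * (cnj (u k) * u k)) = S"
    unfolding S_def by (rule trans[OF sum.swap], intro sum.cong refl, subst w_sym, rule refl)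
  have swapT: "(\<Sum>i\<in>?B. \<Sum>k\<in>?B. w i k * (cnj (u k) * u i)) = T"
    unfolding T_def by (rule trans[OF sum.swap], intro sum.cong refl, subst w_sym, rule refl)
  have sq: "complex_of_real (r * (cmod z)\<^sup>2) = of_real r * (cnj z * z)" for r z
    by (metis complex_norm_square mult.commute of_real_mult)
  have "complex_of_real (\<Sum>i\<in>?B. \<Sum>j | j \<in> ?B \<and> nearest_neighbor d i j.
          \<xi> i j * (cmod (u i - u j))\<^sup>2)
      = (\<Sum>i\<in>?B. \<Sum>j\<in>?B. w i j * (cnj (u i - u j) * (u i - u j)))"
    unfolding nb of_real_sum
    by (intro sum.cong refl) (simp only: sq w_def if_True if_False of_real_0 mult_zero_left split: if_split, blast)
  also have "\<dots> = (\<Sum>i\<in>?B. \<Sum>j\<in>?B. w i j * (cnj (u i) * u i) + w i j * (cnj (u j) * u j)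
        - w i j * (cnj (u i) * u j) - w i j * (cnj (u j) * u i))"
    by (intro sum.cong refl) (simp add: algebra_simps)
  also have "\<dots> = S + S - T - T"
    by (simp only: sum.distrib sum_subtractf swapS swapT flip: S_def T_def)
  finally have E: "complex_of_real (\<Sum>i\<in>?B. \<Sum>j | j \<in> ?B \<and> nearest_neighbor d i j.
          \<xi> i j * (cmod (u i - u j))\<^sup>2) = S + S - T - T" .
  have H: "complex_of_real (\<Sum>i\<in>?B. \<eta> i * (cmod (u i))\<^sup>2) = H"
    unfolding H_def of_real_sum by (intro sum.cong refl) (rule sq)
  show ?thesis
    unfolding lhs of_real_add of_real_mult E H by (simp add: field_simps)
qed

end

theory Submission
  imports Defs "HOL-Analysis.Brouwer_Fixpoint"
begin

text \<open>Eliminating \<open>q\<close>, the eigenvalues of the network matrix are the \<open>\<mu>\<close> for which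
  \<open>m \<mu>\<^sup>2 - m \<mu> \<Gamma> + B\<close> has a kernel. The diagonal of \<open>B\<close> at the impurity \<open>c\<close> is the lowest by a margin, so for \<open>\<mu>\<close> near
  the corresponding imaginary frequency the equations off \<open>c\<close> are diagonally dominant: they have a unique
  solution \<open>v\<close> with \<open>v c = 1\<close>, and it decays geometrically in the distance to \<open>c\<close>. The remaining scalar
  equation at \<open>c\<close> is solved by Brouwer's fixed point theorem. The imaginary part of the energy identity gives
  \<open>2 Re \<mu> \<parallel>v\<parallel>\<^sup>2 = \<langle>v, \<Gamma> v\<rangle>\<close>, and friction only acts at the boundary, where \<open>v\<close> is exponentially small.
  The remaining eigenvalues have nonnegative real part because \<open>B\<close> is positive.\<close>

section \<open>Neumann series for the equations off one anchored vertex of a finite graph\<close>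

primrec neumann_term :: "'a set \<Rightarrow> ('a \<Rightarrow> 'a \<Rightarrow> bool) \<Rightarrow> 'a \<Rightarrow> ('a \<Rightarrow> complex) \<Rightarrow> nat \<Rightarrow> 'a \<Rightarrow> complex" where
  "neumann_term S E c z 0 i = (if i = c then 1 else 0)"
| "neumann_term S E c z (Suc k) i =
     (if i = c then 0 else (\<Sum>j | j \<in> S \<and> E i j. neumann_term S E c z k j) / z i)"

text \<open>A sum over walks: term \<open>k\<close> collects the walks of length \<open>k\<close>
  from \<open>i\<close> that reach \<open>c\<close> only at their last step, weighted by 1 /
  \<open>z j\<close> for every vertex \<open>j\<close> left on the way. This is the Neumann series
  of the system with diagonal \<open>z\<close> and off-diagonal entries -1 along edges, with the
  value at \<open>c\<close> prescribed to be 1.\<close>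

definition anchored_mode :: "'a set \<Rightarrow> ('a \<Rightarrow> 'a \<Rightarrow> bool) \<Rightarrow> 'a \<Rightarrow> ('a \<Rightarrow> complex) \<Rightarrow> 'a \<Rightarrow> complex" where
  "anchored_mode S E c z i = (\<Sum>k. neumann_term S E c z k i)"

definition degree_in :: "'a set \<Rightarrow> ('a \<Rightarrow> 'a \<Rightarrow> bool) \<Rightarrow> 'a \<Rightarrow> real" where
  "degree_in S E i = real (card {j \<in> S. E i j})"

locale anchored_graph =
  fixes S :: "'a set" and E :: "'a \<Rightarrow> 'a \<Rightarrow> bool" and c :: 'a
  assumes finite_S: "finite S"
    and anchor_in: "c \<in> S"
    and edge_sym: "E i j \<longleftrightarrow> E j i"
    and edge_irrefl: "\<not> E i i"
begin

abbreviation deg :: "'a \<Rightarrow> real" where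
  "deg \<equiv> degree_in S E"

text \<open>\<open>\<rho>\<close> is a sup-norm contraction factor for dividing the sum over
  neighbours by \<open>z i\<close>. Nonvanishing is asked separately because at an isolated vertex
  the inequality alone would allow \<open>z i = 0\<close>.\<close>

definition diag_dominant :: "real \<Rightarrow> ('a \<Rightarrow> complex) \<Rightarrow> bool" where
  "diag_dominant \<rho> z \<longleftrightarrow> (\<forall>i\<in>S - {c}. z i \<noteq> 0 \<and> deg i \<le> \<rho> * cmod (z i))"

lemma sum_edges_le:
  assumes "\<And>j. j \<in> S \<Longrightarrow> E i j \<Longrightarrow> cmod (g j) \<le> b"
  shows "cmod (\<Sum>j | j \<in> S \<and> E i j. g j) \<le> deg i * b"
proof -
  have "cmod (\<Sum>j | j \<in> S \<and> E i j. g j) \<le> (\<Sum>j | j \<in> S \<and> E i j. b)"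
    using assms by (intro sum_norm_le) auto
  then show ?thesis by (simp add: degree_in_def)
qed

lemma norm_neumann_term_le:
  assumes "diag_dominant \<rho> z" "0 \<le> \<rho>" "i \<in> S"
  shows "cmod (neumann_term S E c z k i) \<le> \<rho> ^ k"
  using \<open>i \<in> S\<close>
proof (induction k arbitrary: i)
  case (Suc k)
  show ?case
  proof (cases "i = c")
    case False
    then have z: "z i \<noteq> 0" "deg i \<le> \<rho> * cmod (z i)"
      using assms(1) Suc.prems by (auto simp: diag_dominant_def)
    have "cmod (\<Sum>j | j \<in> S \<and> E i j. neumann_term S E c z k j) \<le> deg i * \<rho> ^ k"
      by (rule sum_edges_le) (rule Suc.IH)
    also have "\<dots> \<le> \<rho> * cmod (z i) * \<rho> ^ k"
      using z assms(2) by (intro mult_right_mono) auto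
    finally show ?thesis
      using z False by (simp add: norm_divide field_simps)
  qed (use assms in simp)
qed simp

lemma summable_neumann_term:
  assumes "diag_dominant \<rho> z" "0 \<le> \<rho>" "\<rho> < 1" "i \<in> S"
  shows "summable (\<lambda>k. neumann_term S E c z k i)"
  by (rule summable_comparison_test[OF _ summable_geometric[of \<rho>]])
    (use assms norm_neumann_term_le[of \<rho> z i] in auto)

lemma anchored_mode_anchor:
  assumes "diag_dominant \<rho> z" "0 \<le> \<rho>" "\<rho> < 1"
  shows "anchored_mode S E c z c = 1"
proof -
  have "neumann_term S E c z k c = (if k = 0 then 1 else 0)" for k
    by (cases k) auto
  then show ?thesis
    unfolding anchored_mode_def by (subst suminf_finite[of "{0}"]) auto
qed

text \<open>Off \<open>c\<close> the zeroth term vanishes, so shifting the index by one turns the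
  recursion of the terms into the equation; the finite sum over neighbours commutes with the
  convergent series.\<close>

lemma anchored_mode_eq:
  assumes "diag_dominant \<rho> z" "0 \<le> \<rho>" "\<rho> < 1" "i \<in> S" "i \<noteq> c"
  shows "z i * anchored_mode S E c z i = (\<Sum>j | j \<in> S \<and> E i j. anchored_mode S E c z j)"
proof -
  have sm: "summable (\<lambda>k. neumann_term S E c z k j)" if "j \<in> S" for j
    using summable_neumann_term[OF assms(1-3) that] .
  have z: "z i \<noteq> 0"
    using assms by (auto simp: diag_dominant_def)
  have "anchored_mode S E c z i = (\<Sum>k. neumann_term S E c z (Suc k) i)"
    unfolding anchored_mode_def using suminf_split_head[OF sm[OF assms(4)]] assms(5) by simp
  also have "\<dots> = (\<Sum>k. (\<Sum>j | j \<in> S \<and> E i j. neumann_term S E c z k j) / z i)"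
    using assms(5) by simp
  also have "\<dots> = (\<Sum>k. \<Sum>j | j \<in> S \<and> E i j. neumann_term S E c z k j) / z i"
    by (rule suminf_divide, rule summable_sum) (use sm in auto)
  also have "(\<Sum>k. \<Sum>j | j \<in> S \<and> E i j. neumann_term S E c z k j) =
      (\<Sum>j | j \<in> S \<and> E i j. anchored_mode S E c z j)"
    unfolding anchored_mode_def by (rule suminf_sum) (use sm in auto)
  finally show ?thesis using z by simp
qed

text \<open>Maximum principle: if the maximum modulus \<open>M\<close> were attained off
  \<open>c\<close>, the equation there would give \<open>M \<le> \<rho> * M\<close>, hence
  \<open>M \<le> 0\<close>. So \<open>M\<close> is at most the value 1 at \<open>c\<close>. Summing
  the geometric majorant would only give 1 / (1 - \<open>\<rho>\<close>).\<close>

lemma norm_anchored_mode_le_1: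
  assumes dom: "diag_dominant \<rho> z" "0 \<le> \<rho>" "\<rho> < 1" and "i \<in> S"
  shows "cmod (anchored_mode S E c z i) \<le> 1"
proof -
  let ?v = "anchored_mode S E c z"
  define M where "M = Max ((\<lambda>i. cmod (?v i)) ` S)"
  have M_ge: "cmod (?v j) \<le> M" if "j \<in> S" for j
    unfolding M_def using finite_S that by (intro Max_ge) auto
  have "M \<in> (\<lambda>i. cmod (?v i)) ` S"
    unfolding M_def using finite_S anchor_in by (intro Max_in) auto
  then obtain k where k: "k \<in> S" "M = cmod (?v k)" by auto
  show ?thesis
  proof (cases "k = c")
    case True
    then show ?thesis
      using M_ge[OF \<open>i \<in> S\<close>] k anchored_mode_anchor[OF dom] by simp
  next
    case False
    have z: "z k \<noteq> 0" "deg k \<le> \<rho> * cmod (z k)"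
      using dom k False by (auto simp: diag_dominant_def)
    have "cmod (z k) * M = cmod (\<Sum>j | j \<in> S \<and> E k j. ?v j)"
      using anchored_mode_eq[OF dom k(1) False] k(2) by (metis norm_mult)
    also have "\<dots> \<le> deg k * M"
      by (rule sum_edges_le) (rule M_ge)
    also have "\<dots> \<le> \<rho> * cmod (z k) * M"
      using z k(2) by (intro mult_right_mono) auto
    finally have "cmod (z k) * M \<le> cmod (z k) * (\<rho> * M)" by (simp add: ac_simps)
    then have "M \<le> \<rho> * M"
      using z(1) mult_le_cancel_left_pos[of "cmod (z k)" M "\<rho> * M"] by simp
    then have "M \<le> 0"
      using mult_strict_right_mono[of \<rho> 1 M] dom(3) by linarith
    then show ?thesis using M_ge[OF \<open>i \<in> S\<close>] by linarith
  qed
qed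

text \<open>Each use of the equation gains a factor \<open>\<rho>\<close> and lowers
  \<open>f\<close> by at most one, so it can be repeated \<open>f i\<close> times before reaching
  the anchor. Any such \<open>f\<close> is a lower bound for the graph distance to \<open>c\<close>.
  The induction runs over \<open>k \<le> f i\<close> because neighbours may have different values of
  \<open>f\<close>.\<close>

lemma norm_anchored_mode_le:
  assumes dom: "diag_dominant \<rho> z" "0 \<le> \<rho>" "\<rho> < 1"
    and dist: "f c = 0" "\<And>i j. E i j \<Longrightarrow> f i \<le> Suc (f j)"
    and "i \<in> S" "k \<le> f i"
  shows "cmod (anchored_mode S E c z i) \<le> \<rho> ^ k"
  using \<open>i \<in> S\<close> \<open>k \<le> f i\<close>
proof (induction k arbitrary: i)
  case 0
  then show ?case using norm_anchored_mode_le_1[OF dom] by simp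
next
  case (Suc k)
  then have "i \<noteq> c" using dist(1) by auto
  then have z: "z i \<noteq> 0" "deg i \<le> \<rho> * cmod (z i)"
    using dom Suc.prems by (auto simp: diag_dominant_def)
  have "cmod (z i) * cmod (anchored_mode S E c z i) =
      cmod (\<Sum>j | j \<in> S \<and> E i j. anchored_mode S E c z j)"
    using anchored_mode_eq[OF dom Suc.prems(1) \<open>i \<noteq> c\<close>] by (metis norm_mult)
  also have "\<dots> \<le> deg i * \<rho> ^ k"
    by (rule sum_edges_le) (use Suc dist(2) in force)
  also have "\<dots> \<le> \<rho> * cmod (z i) * \<rho> ^ k"
    using z dom by (intro mult_right_mono) auto
  finally show ?case using z by (simp add: field_simps)
qed

lemma continuous_on_neumann_term:
  assumes "\<And>j. j \<in> S - {c} \<Longrightarrow> continuous_on T (\<lambda>t. z t j)"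
    and "\<And>t j. t \<in> T \<Longrightarrow> j \<in> S - {c} \<Longrightarrow> z t j \<noteq> 0"
    and "i \<in> S"
  shows "continuous_on T (\<lambda>t. neumann_term S E c (z t) k i)"
  using \<open>i \<in> S\<close>
proof (induction k arbitrary: i)
  case (Suc k)
  show ?case
  proof (cases "i = c")
    case False
    have "continuous_on T (\<lambda>t. (\<Sum>j | j \<in> S \<and> E i j. neumann_term S E c (z t) k j) / z t i)"
      using assms(1,2) Suc.prems False by (intro continuous_on_divide continuous_on_sum Suc.IH) auto
    with False show ?thesis by simp
  qed simp
qed simp

text \<open>The majorant \<open>\<rho> ^ k\<close> does not depend on \<open>t\<close>, so the
  series converges uniformly and the limit inherits the continuity of the partial sums. Brouwer's
  theorem will need this.\<close>

lemma continuous_on_anchored_mode: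
  assumes cont: "\<And>j. j \<in> S - {c} \<Longrightarrow> continuous_on T (\<lambda>t. z t j)"
    and dom: "\<And>t. t \<in> T \<Longrightarrow> diag_dominant \<rho> (z t)" and \<rho>: "0 \<le> \<rho>" "\<rho> < 1"
    and "i \<in> S"
  shows "continuous_on T (\<lambda>t. anchored_mode S E c (z t) i)"
  unfolding anchored_mode_def
proof (rule uniform_limit_theorem)
  show "uniform_limit T (\<lambda>n t. \<Sum>k<n. neumann_term S E c (z t) k i)
      (\<lambda>t. \<Sum>k. neumann_term S E c (z t) k i) sequentially"
    using norm_neumann_term_le dom \<rho> \<open>i \<in> S\<close>
    by (intro Weierstrass_m_test[where M = "\<lambda>k. \<rho> ^ k"] summable_geometric) auto
  show "\<forall>\<^sub>F n in sequentially. continuous_on T (\<lambda>t. \<Sum>k<n. neumann_term S E c (z t) k i)"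
    using cont dom \<open>i \<in> S\<close>
    by (intro always_eventually allI continuous_intros continuous_on_neumann_term)
      (auto simp: diag_dominant_def)
qed simp

section \<open>Energy identity and construction of the localized mode\<close>

text \<open>Multiply the equation at \<open>i\<close> by the conjugate of \<open>v i\<close> and sum
  over the vertices other than \<open>c\<close>. The edges at \<open>c\<close> contribute the
  conjugate of the neighbour sum at \<open>c\<close>, since \<open>v c = 1\<close>; the remaining
  edges contribute a Hermitian form \<open>T\<close>. The form is real, which gives the imaginary
  part, and it is at most the degree-weighted norm, which gives the sign of the real part.\<close>

lemma energy_identity:
  assumes anchor: "v c = 1"
    and eq: "\<And>i. i \<in> S - {c} \<Longrightarrow> z i * v i = (\<Sum>j | j \<in> S \<and> E i j. v j)"
    and Re_ge: "\<And>i. i \<in> S - {c} \<Longrightarrow> deg i \<le> Re (z i)"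
  shows "0 \<le> Re (\<Sum>j | j \<in> S \<and> E c j. v j)"
    and "Im (\<Sum>j | j \<in> S \<and> E c j. v j) = - (\<Sum>i\<in>S - {c}. Im (z i) * (cmod (v i))\<^sup>2)"
proof -
  let ?A = "S - {c}"
  define G where "G = (\<Sum>j | j \<in> S \<and> E c j. v j)"
  define e where "e i j = (if E i j then 1 else 0 :: real)" for i j
  define T where "T = (\<Sum>i\<in>?A. \<Sum>j\<in>?A. of_real (e i j) * (cnj (v i) * v j))"
  have e_sym: "e i j = e j i" for i j
    unfolding e_def by (metis edge_sym)
  have nb: "(\<Sum>j | j \<in> S \<and> E i j. g j) = (\<Sum>j\<in>S. of_real (e i j) * g j)" for i and g :: "'a \<Rightarrow> complex"
    unfolding sum.inter_filter[OF finite_S] e_def by (intro sum.cong) auto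
  have split: "(\<Sum>j\<in>S. g j) = g c + (\<Sum>j\<in>?A. g j)" for g :: "'a \<Rightarrow> complex"
    using finite_S anchor_in by (rule sum.remove)
  have "cnj G = (\<Sum>i\<in>?A. of_real (e c i) * cnj (v i))"
    unfolding G_def nb split by (simp add: e_def edge_irrefl)
  also have "\<dots> = (\<Sum>i\<in>?A. of_real (e i c) * cnj (v i))"
    by (subst e_sym) (rule refl)
  finally have G: "cnj G = (\<Sum>i\<in>?A. of_real (e i c) * cnj (v i))" .
  have row: "z i * of_real ((cmod (v i))\<^sup>2) =
      of_real (e i c) * cnj (v i) + (\<Sum>j\<in>?A. of_real (e i j) * (cnj (v i) * v j))" if "i \<in> ?A" for i
  proof -
    have "z i * of_real ((cmod (v i))\<^sup>2) = cnj (v i) * (z i * v i)"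
      by (simp add: complex_norm_square ac_simps del: of_real_power)
    also have "\<dots> = cnj (v i) * (\<Sum>j\<in>S. of_real (e i j) * v j)"
      using eq[OF that] by (simp add: nb)
    finally show ?thesis
      unfolding split by (simp add: anchor distrib_left sum_distrib_left ac_simps)
  qed
  have main: "(\<Sum>i\<in>?A. z i * of_real ((cmod (v i))\<^sup>2)) = cnj G + T"
    unfolding G T_def sum.distrib[symmetric] by (intro sum.cong refl row)
  have "cnj T = (\<Sum>i\<in>?A. \<Sum>j\<in>?A. of_real (e i j) * (v i * cnj (v j)))"
    by (simp add: T_def)
  also have "\<dots> = (\<Sum>i\<in>?A. \<Sum>j\<in>?A. of_real (e j i) * (v j * cnj (v i)))"
    by (rule sum.swap)
  also have "\<dots> = T"
    unfolding T_def by (intro sum.cong refl) (subst e_sym, subst mult.commute[of "v _"], rule refl)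
  finally have "cnj T = T" .
  then have ImT: "Im T = 0"
    by (metis Im_complex_of_real Reals_cnj_iff complex_is_Real_iff)
  have row_deg: "(\<Sum>j\<in>?A. e i j) \<le> deg i" if "i \<in> S" for i
  proof -
    have "(\<Sum>j\<in>?A. e i j) \<le> (\<Sum>j\<in>S. e i j)"
      using finite_S by (intro sum_mono2) (auto simp: e_def)
    also have "\<dots> = deg i"
      unfolding degree_in_def e_def using finite_S
      by (simp add: sum.If_cases Int_def)
    finally show ?thesis .
  qed
  have "Re T = (\<Sum>i\<in>?A. \<Sum>j\<in>?A. e i j * Re (cnj (v i) * v j))"
    by (simp add: T_def)
  \<comment> \<open>The two halves of the arithmetic-geometric bound carry \<open>e i j\<close> and
    \<open>e j i\<close>, so that exchanging the two sums makes them equal and the degree of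
    \<open>i\<close> appears.\<close>
  also have "\<dots> \<le> (\<Sum>i\<in>?A. \<Sum>j\<in>?A. e i j * (cmod (v i))\<^sup>2 / 2 + e j i * (cmod (v j))\<^sup>2 / 2)"
  proof (intro sum_mono)
    fix i j
    have "Re (cnj (v i) * v j) \<le> cmod (v i) * cmod (v j)"
      by (metis complex_Re_le_cmod complex_mod_cnj norm_mult)
    also have "\<dots> \<le> (cmod (v i))\<^sup>2 / 2 + (cmod (v j))\<^sup>2 / 2"
      using sum_squares_bound[of "cmod (v i)" "cmod (v j)"] by simp
    finally have "e i j * Re (cnj (v i) * v j) \<le> e i j * ((cmod (v i))\<^sup>2 / 2 + (cmod (v j))\<^sup>2 / 2)"
      by (intro mult_left_mono) (auto simp: e_def)
    then show "e i j * Re (cnj (v i) * v j) \<le> e i j * (cmod (v i))\<^sup>2 / 2 + e j i * (cmod (v j))\<^sup>2 / 2"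
      by (simp add: e_sym[of j i] algebra_simps)
  qed
  also have "\<dots> = (\<Sum>i\<in>?A. \<Sum>j\<in>?A. e i j * (cmod (v i))\<^sup>2 / 2)
      + (\<Sum>i\<in>?A. \<Sum>j\<in>?A. e j i * (cmod (v j))\<^sup>2 / 2)"
    by (simp add: sum.distrib)
  also have "(\<Sum>i\<in>?A. \<Sum>j\<in>?A. e j i * (cmod (v j))\<^sup>2 / 2) = (\<Sum>i\<in>?A. \<Sum>j\<in>?A. e i j * (cmod (v i))\<^sup>2 / 2)"
    by (rule sum.swap)
  also have "(\<Sum>i\<in>?A. \<Sum>j\<in>?A. e i j * (cmod (v i))\<^sup>2 / 2) + (\<Sum>i\<in>?A. \<Sum>j\<in>?A. e i j * (cmod (v i))\<^sup>2 / 2)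
      = (\<Sum>i\<in>?A. (\<Sum>j\<in>?A. e i j) * (cmod (v i))\<^sup>2)"
    by (simp add: sum.distrib[symmetric] sum_distrib_right)
  also have "\<dots> \<le> (\<Sum>i\<in>?A. Re (z i) * (cmod (v i))\<^sup>2)"
    using row_deg Re_ge by (intro sum_mono mult_right_mono) force+
  finally have "Re T \<le> (\<Sum>i\<in>?A. Re (z i) * (cmod (v i))\<^sup>2)" .
  moreover have "(\<Sum>i\<in>?A. Re (z i) * (cmod (v i))\<^sup>2) = Re G + Re T"
    using arg_cong[OF main, of Re] by simp
  ultimately show "0 \<le> Re (\<Sum>j | j \<in> S \<and> E c j. v j)"
    by (simp add: G_def)
  have "(\<Sum>i\<in>?A. Im (z i) * (cmod (v i))\<^sup>2) = - Im G"
    using arg_cong[OF main, of Im] ImT by simp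
  then show "Im (\<Sum>j | j \<in> S \<and> E c j. v j) = - (\<Sum>i\<in>?A. Im (z i) * (cmod (v i))\<^sup>2)"
    by (simp add: G_def)
qed

text \<open>Taking the real parts \<open>x\<close> of \<open>\<mu>\<close> and \<open>s\<close> of
  \<open>m \<mu>\<^sup>2\<close> as unknowns makes the rectangle below invariant: the equation for \<open>x\<close> is the imaginary part of the energy
  identity, whose right-hand side is nonnegative.\<close>

lemma exists_localized_mode:
  fixes \<eta> g :: "'a \<Rightarrow> real" and m \<epsilon> \<gamma> \<Delta> \<rho> :: real and f :: "'a \<Rightarrow> nat"
  assumes m: "m > 0" and \<epsilon>: "\<epsilon> > 0" and \<gamma>: "\<gamma> > 0" and \<Delta>: "\<Delta> \<ge> 0"
    and deg_le: "\<And>i. i \<in> S \<Longrightarrow> deg i \<le> \<Delta>"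
    and \<eta>c: "\<eta> c > 0"
    and gap: "\<And>i. i \<in> S - {c} \<Longrightarrow> \<eta> c + deg c + \<epsilon> \<le> \<eta> i"
    and gc: "g c = 0"
    and g: "\<And>i. i \<in> S \<Longrightarrow> 0 \<le> g i" "\<And>i. i \<in> S \<Longrightarrow> g i \<le> \<gamma>"
    and dist: "f c = 0" "\<And>i j. E i j \<Longrightarrow> f i \<le> Suc (f j)"
    and far: "\<And>i. i \<in> S \<Longrightarrow> g i \<noteq> 0 \<Longrightarrow> L \<le> f i"
    and \<rho>_def: "\<rho> = \<Delta> / (\<Delta> + \<epsilon> / 2)"
    and small: "\<gamma> / 2 * real (card S) * \<rho> ^ (2 * L) \<le> \<epsilon> / (2 * m * \<gamma>)"
  obtains \<mu> :: complex and v :: "'a \<Rightarrow> complex"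
  where "v c = 1" "0 \<le> Re \<mu>" "Re \<mu> \<le> \<gamma> / 2 * real (card S) * \<rho> ^ (2 * L)"
    "\<And>i. i \<in> S \<Longrightarrow> (of_real m * \<mu>\<^sup>2 - of_real m * \<mu> * of_real (g i) + of_real (deg i + \<eta> i)) * v i
        = (\<Sum>j | j \<in> S \<and> E i j. v j)"
proof -
  define D where "D = \<eta> c + deg c"
  \<comment> \<open>Chosen so that m * r * \<open>\<gamma>\<close> = \<open>\<epsilon>\<close> / 2:
    the friction term uses up at most half of the margin \<open>\<epsilon>\<close>, and the other
    half is left for diagonal dominance.\<close>
  define r where "r = \<epsilon> / (2 * m * \<gamma>)"
  define R where "R = cbox (0, - D) (r, - \<eta> c)"
  \<comment> \<open>Recovers the eigenvalue from its real part x and s = Re (m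
    \<open>\<mu>\<close>^2): the square of the imaginary part is x^2 - s / m, which is positive on
    \<open>R\<close> because s is negative there.\<close>
  define lam where "lam t = Complex (fst t) (sqrt ((fst t)\<^sup>2 - snd t / m))" for t :: "real \<times> real"
  define z where "z t i = of_real m * (lam t)\<^sup>2 - of_real m * lam t * of_real (g i) + of_real (deg i + \<eta> i)" for t i
  define v where "v t = anchored_mode S E c (z t)" for t
  define W where "W t = (\<Sum>i\<in>S. (cmod (v t i))\<^sup>2)" for t
  define X where "X t = (\<Sum>i\<in>S. g i * (cmod (v t i))\<^sup>2) / (2 * W t)" for t
  define G where "G t = (\<Sum>j | j \<in> S \<and> E c j. v t j)" for t
  \<comment> \<open>A fixed point satisfies two equations: x is half the Rayleigh quotient of the
    friction, and s + \<open>D\<close> = \<open>Re (G t)\<close>, which is the real part of the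
    equation at \<open>c\<close>, where friction vanishes.\<close>
  define \<Phi> where "\<Phi> t = (X t, - D + Re (G t))" for t
  have \<rho>: "0 \<le> \<rho>" "\<rho> < 1"
    using \<Delta> \<epsilon> by (auto simp: \<rho>_def divide_simps)
  have deg_nonneg: "0 \<le> deg i" for i by (simp add: degree_in_def)
  have r: "r > 0" using m \<epsilon> \<gamma> by (simp add: r_def)
  have R: "t \<in> R \<longleftrightarrow> 0 \<le> fst t \<and> fst t \<le> r \<and> - D \<le> snd t \<and> snd t \<le> - \<eta> c" for t
    by (cases t) (auto simp: R_def cbox_Pair_eq)
  have Re_sq: "m * ((Re (lam t))\<^sup>2 - (Im (lam t))\<^sup>2) = snd t" if "t \<in> R" for t
  proof -
    have "snd t / m \<le> 0" using that R \<eta>c m by (simp add: divide_nonpos_pos)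
    then have "(Im (lam t))\<^sup>2 = (fst t)\<^sup>2 - snd t / m"
      by (simp add: lam_def order_trans[OF _ zero_le_power2])
    then show ?thesis using m by (simp add: lam_def)
  qed
  have Re_z: "Re (z t i) = snd t - m * fst t * g i + deg i + \<eta> i" if "t \<in> R" for t i
    using Re_sq[OF that] by (simp add: z_def power2_eq_square algebra_simps) (simp add: lam_def)
  have Im_z: "Im (z t i) = 2 * m * fst t * Im (lam t) - m * Im (lam t) * g i" for t i
    by (simp add: z_def power2_eq_square algebra_simps) (simp add: lam_def)
  have Re_z_ge: "deg i + \<epsilon> / 2 \<le> Re (z t i)" if "t \<in> R" "i \<in> S - {c}" for t i
  proof -
    have "fst t * g i \<le> r * \<gamma>"
      using that R[of t] g[of i] r by (intro mult_mono) auto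
    then have "m * fst t * g i \<le> m * (r * \<gamma>)"
      using m by (simp add: mult.assoc)
    also have "\<dots> = \<epsilon> / 2" using m \<gamma> by (simp add: r_def)
    finally show ?thesis
      using that R[of t] gap[of i] unfolding Re_z[OF that(1)] D_def by simp
  qed
  have dom: "diag_dominant \<rho> (z t)" if "t \<in> R" for t
    unfolding diag_dominant_def
  proof
    fix i assume i: "i \<in> S - {c}"
    have "deg i + \<epsilon> / 2 \<le> cmod (z t i)"
      using Re_z_ge[OF that i] complex_Re_le_cmod[of "z t i"] by linarith
    \<comment> \<open>The ratio x / (x + \<open>\<epsilon>\<close> / 2) increases with x, so the
      degree bound \<open>\<Delta>\<close> yields the uniform factor \<open>\<rho>\<close>.\<close>
    moreover have "deg i * (\<Delta> + \<epsilon> / 2) \<le> \<Delta> * (deg i + \<epsilon> / 2)"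
      using deg_le[of i] i \<epsilon> by (simp add: algebra_simps)
    then have "deg i \<le> \<rho> * (deg i + \<epsilon> / 2)"
      using \<Delta> \<epsilon> by (simp add: \<rho>_def pos_le_divide_eq)
    ultimately show "z t i \<noteq> 0 \<and> deg i \<le> \<rho> * cmod (z t i)"
      using mult_left_mono[of "deg i + \<epsilon> / 2" "cmod (z t i)" \<rho>] \<rho> \<epsilon> deg_nonneg[of i] by auto
  qed
  have vc: "v t c = 1" if "t \<in> R" for t
    unfolding v_def using anchored_mode_anchor[OF dom[OF that] \<rho>] .
  have v_eq: "z t i * v t i = (\<Sum>j | j \<in> S \<and> E i j. v t j)" if "t \<in> R" "i \<in> S - {c}" for t i
    unfolding v_def using anchored_mode_eq[OF dom[OF that(1)] \<rho>] that(2) by auto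
  have W_split: "W t = 1 + (\<Sum>i\<in>S - {c}. (cmod (v t i))\<^sup>2)" if "t \<in> R" for t
    unfolding W_def using vc[OF that] by (subst sum.remove[OF finite_S anchor_in]) simp
  have W_ge: "1 \<le> W t" if "t \<in> R" for t
    unfolding W_split[OF that] by (simp add: sum_nonneg)
  have X_nonneg: "0 \<le> X t" if "t \<in> R" for t
    unfolding X_def using W_ge[OF that] g by (intro divide_nonneg_nonneg sum_nonneg) auto
  \<comment> \<open>Friction acts only where \<open>L \<le> f i\<close>, so each of the at most
    \<open>card S\<close> terms has the factor \<open>\<rho> ^ (2 * L)\<close>; the denominator is
    harmless because \<open>W t\<close> contains the anchor's contribution 1.\<close>
  have X_le: "X t \<le> \<gamma> / 2 * real (card S) * \<rho> ^ (2 * L)" if "t \<in> R" for t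
  proof -
    have le: "g i * (cmod (v t i))\<^sup>2 \<le> \<gamma> * \<rho> ^ (2 * L)" if i: "i \<in> S" for i
    proof (cases "g i = 0")
      case False
      have "cmod (v t i) \<le> \<rho> ^ L"
        unfolding v_def using norm_anchored_mode_le[OF dom[OF \<open>t \<in> R\<close>] \<rho> dist i far[OF i False]] .
      then have "(cmod (v t i))\<^sup>2 \<le> (\<rho> ^ L)\<^sup>2"
        by (intro power_mono) auto
      then show ?thesis
        using g[OF i] \<gamma> by (intro mult_mono) (auto simp: power_mult[symmetric] mult.commute)
    qed (use \<gamma> \<rho> in simp)
    have "X t \<le> (\<Sum>i\<in>S. g i * (cmod (v t i))\<^sup>2) / 2"
      unfolding X_def using W_ge[OF that] g by (intro divide_left_mono sum_nonneg) auto
    also have "\<dots> \<le> (\<Sum>i\<in>S. \<gamma> * \<rho> ^ (2 * L)) / 2"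
      using le by (intro divide_right_mono sum_mono) auto
    finally show ?thesis by (simp add: mult_ac)
  qed
  have energy: "0 \<le> Re (G t)" "Im (G t) = - (\<Sum>i\<in>S - {c}. Im (z t i) * (cmod (v t i))\<^sup>2)"
    if "t \<in> R" for t
    unfolding G_def using energy_identity[OF vc v_eq, OF that that] Re_z_ge[OF that] \<epsilon> by force+
  have "cmod (G t) \<le> deg c * 1" if "t \<in> R" for t
    unfolding G_def v_def using norm_anchored_mode_le_1[OF dom[OF that] \<rho>] by (intro sum_edges_le)
  then have Re_G_le: "Re (G t) \<le> deg c" if "t \<in> R" for t
    using that complex_Re_le_cmod[of "G t"] by fastforce
  \<comment> \<open>\<open>small\<close> keeps the first component below \<open>r\<close>. The
    energy identity and the bound 1 on the mode keep \<open>Re (G t)\<close> between 0 and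
    \<open>deg c\<close>, which is exactly the height of the rectangle.\<close>
  have maps: "\<Phi> \<in> R \<rightarrow> R"
  proof
    fix t assume t: "t \<in> R"
    show "\<Phi> t \<in> R"
      using X_nonneg[OF t] order_trans[OF X_le[OF t] small] energy(1)[OF t] Re_G_le[OF t]
      unfolding R \<Phi>_def D_def r_def by simp
  qed
  have cont_v: "continuous_on R (\<lambda>t. v t i)" if "i \<in> S" for i
    unfolding v_def
  proof (rule continuous_on_anchored_mode[OF _ dom \<rho> that])
    show "continuous_on R (\<lambda>t. z t j)" for j
      unfolding z_def lam_def complex_eq by (intro continuous_intros) (use m in auto)
  qed
  have "continuous_on R \<Phi>"
    unfolding \<Phi>_def X_def G_def W_def
    by (intro continuous_intros cont_v) (use W_ge in \<open>force simp: W_def\<close>)+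
  moreover have "compact R" "convex R" by (simp_all add: R_def convex_box)
  moreover have "R \<noteq> {}"
    using r deg_nonneg[of c] by (auto simp: R_def D_def cbox_Pair_eq)
  ultimately obtain t where t: "t \<in> R" "\<Phi> t = t"
    using brouwer maps by metis
  then have x: "fst t = X t" and s: "snd t = - D + Re (G t)"
    by (metis \<Phi>_def fst_conv, metis \<Phi>_def snd_conv)
  let ?y = "Im (lam t)"
  have Re_lam: "Re (lam t) = X t" using x by (simp add: lam_def)
  have "z t c = G t"
  proof (rule complex_eqI)
    show "Re (z t c) = Re (G t)"
      using s by (simp add: Re_z[OF t(1)] gc D_def)
    \<comment> \<open>The imaginary part of the equation at \<open>c\<close> comes for free:
      inserting the fixed-point equation for x into the energy identity cancels everything except
      the share of \<open>c\<close> in \<open>W t\<close>, and that share is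
      \<open>Im (z t c)\<close>.\<close>
    have "2 * X t * W t = (\<Sum>i\<in>S. g i * (cmod (v t i))\<^sup>2)"
      using W_ge[OF t(1)] by (simp add: X_def)
    also have "\<dots> = (\<Sum>i\<in>S - {c}. g i * (cmod (v t i))\<^sup>2)"
      by (subst sum.remove[OF finite_S anchor_in]) (simp add: gc)
    finally have eq: "2 * X t * W t = (\<Sum>i\<in>S - {c}. g i * (cmod (v t i))\<^sup>2)" .
    have "Im (G t) = - (\<Sum>i\<in>S - {c}. (2 * m * X t * ?y - m * ?y * g i) * (cmod (v t i))\<^sup>2)"
      using energy(2)[OF t(1)] by (simp add: Im_z x)
    also have "\<dots> = m * ?y * (\<Sum>i\<in>S - {c}. g i * (cmod (v t i))\<^sup>2)
        - 2 * m * X t * ?y * (\<Sum>i\<in>S - {c}. (cmod (v t i))\<^sup>2)"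
      by (simp add: sum_distrib_left algebra_simps sum_subtractf)
    also have "\<dots> = 2 * m * X t * ?y"
      unfolding eq[symmetric] W_split[OF t(1)] by (simp add: algebra_simps)
    finally show "Im (z t c) = Im (G t)"
      by (simp add: Im_z gc x)
  qed
  show thesis
  proof (rule that[of "v t" "lam t"])
    show "v t c = 1" using vc[OF t(1)] .
    show "0 \<le> Re (lam t)" "Re (lam t) \<le> \<gamma> / 2 * real (card S) * \<rho> ^ (2 * L)"
      unfolding Re_lam using X_nonneg X_le t(1) by auto
    show "(of_real m * (lam t)\<^sup>2 - of_real m * lam t * of_real (g i) + of_real (deg i + \<eta> i)) * v t i
        = (\<Sum>j | j \<in> S \<and> E i j. v t j)" if "i \<in> S" for i
      using that v_eq[OF t(1), of i] \<open>z t c = G t\<close> vc[OF t(1)]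
      by (cases "i = c") (auto simp: z_def G_def)
  qed
qed

end

section \<open>The eigenvalue problem in site coordinates and the sign of the spectrum\<close>

definition site_vec :: "nat \<Rightarrow> nat \<Rightarrow> (site \<Rightarrow> complex) \<Rightarrow> complex Matrix.vec" where
  "site_vec d N u = Matrix.vec (card (site_box d N)) (\<lambda>a. u (from_nat_into (site_box d N) a))"

lemma site_vec_carrier [simp]: "site_vec d N u \<in> carrier_vec (card (site_box d N))"
  by (simp add: site_vec_def)

lemma site_mat_carrier [simp]: "site_mat d N K \<in> carrier_mat (card (site_box d N)) (card (site_box d N))"
  by (simp add: site_mat_def)

lemma site_vec_eq_iff: "site_vec d N u = site_vec d N w \<longleftrightarrow> (\<forall>i\<in>site_box d N. u i = w i)"
proof -
  have "site_vec d N u = site_vec d N w \<longleftrightarrow>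
      (\<forall>a<card (site_box d N). u (from_nat_into (site_box d N) a) = w (from_nat_into (site_box d N) a))"
    by (auto simp: site_vec_def Matrix.vec_eq_iff)
  also have "\<dots> \<longleftrightarrow> (\<forall>i\<in>from_nat_into (site_box d N) ` {..<card (site_box d N)}. u i = w i)"
    by auto
  finally show ?thesis
    using bij_betw_imp_surj_on[OF bij_betw_site_enumeration] by metis
qed

lemma site_vec_surj:
  assumes "x \<in> carrier_vec (card (site_box d N))"
  obtains u where "x = site_vec d N u"
proof
  let ?h = "from_nat_into (site_box d N)" and ?A = "{..<card (site_box d N)}"
  have "inj_on ?h ?A"
    using bij_betw_site_enumeration by (rule bij_betw_imp_inj_on)
  then show "x = site_vec d N (\<lambda>i. vec_index x (the_inv_into ?A ?h i))"
    using assms by (intro eq_vecI) (auto simp: site_vec_def the_inv_into_f_f)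
qed

lemma site_mat_mult_vec:
  "site_mat d N K *\<^sub>v site_vec d N u = site_vec d N (\<lambda>i. \<Sum>j\<in>site_box d N. K i j * u j)"
proof (rule eq_vecI)
  let ?h = "from_nat_into (site_box d N)" and ?n = "card (site_box d N)"
  fix a assume "a < dim_vec (site_vec d N (\<lambda>i. \<Sum>j\<in>site_box d N. K i j * u j))"
  then have a: "a < ?n" by (simp add: site_vec_def)
  then have "vec_index (site_mat d N K *\<^sub>v site_vec d N u) a = (\<Sum>b<?n. K (?h a) (?h b) * u (?h b))"
    by (simp add: site_mat_def site_vec_def scalar_prod_def lessThan_atLeast0)
  also have "\<dots> = (\<Sum>j\<in>site_box d N. K (?h a) j * u j)"
    using bij_betw_site_enumeration by (rule sum.reindex_bij_betw)
  finally show "vec_index (site_mat d N K *\<^sub>v site_vec d N u) a =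
      vec_index (site_vec d N (\<lambda>i. \<Sum>j\<in>site_box d N. K i j * u j)) a"
    using a by (simp add: site_vec_def)
qed (simp add: site_mat_def site_vec_def)

lemma site_diag_mat_mult_vec:
  "site_diag_mat d N f *\<^sub>v site_vec d N u = site_vec d N (\<lambda>i. complex_of_real (f i) * u i)"
proof -
  have "(\<Sum>j\<in>site_box d N. (if i = j then complex_of_real (f i) else 0) * u j) = complex_of_real (f i) * u i"
    if "i \<in> site_box d N" for i
    using that finite_site_box by (simp add: if_distrib[of "\<lambda>x. x * _"] cong: if_cong)
  then show ?thesis
    unfolding site_diag_mat_def site_mat_mult_vec site_vec_eq_iff by blast
qed

lemma network_mat_mult_vec:
  "network_mat d N m \<xi> \<eta> I \<gamma> *\<^sub>v (site_vec d N p @\<^sub>v site_vec d N q) =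
     site_vec d N (\<lambda>i. complex_of_real (if i \<in> I then \<gamma> i else 0) * p i - q i / complex_of_real (m i)) @\<^sub>v
     site_vec d N (\<lambda>i. \<Sum>j\<in>site_box d N. complex_of_real (schroedinger_entry d N \<xi> \<eta> i j) * p j)"
proof -
  have [simp]: "site_diag_mat d N f \<in> carrier_mat (card (site_box d N)) (card (site_box d N))" for f
    by (simp add: site_diag_mat_def)
  have [simp]: "schroedinger_mat d N \<xi> \<eta> \<in> carrier_mat (card (site_box d N)) (card (site_box d N))"
    by (simp add: schroedinger_mat_def)
  have minus: "- site_diag_mat d N (\<lambda>i. 1 / m i) = site_diag_mat d N (\<lambda>i. - (1 / m i))"
    by (intro eq_matI) (auto simp: site_diag_mat_def site_mat_def)
  have "0\<^sub>m (card (site_box d N)) (card (site_box d N)) *\<^sub>v site_vec d N q = 0\<^sub>v (card (site_box d N))"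
    by (intro eq_vecI) (auto simp: site_vec_def)
  moreover have "site_vec d N u + site_vec d N w = site_vec d N (\<lambda>i. u i + w i)" for u w
    by (intro eq_vecI) (auto simp: site_vec_def)
  moreover have "site_vec d N u + 0\<^sub>v (card (site_box d N)) = site_vec d N u" for u
    by (intro right_zero_vec site_vec_carrier)
  ultimately show ?thesis
    unfolding network_mat_def minus
    by (subst four_block_mat_mult_vec[where ?nr1.0 = "card (site_box d N)" and ?nr2.0 = "card (site_box d N)"
          and ?nc1.0 = "card (site_box d N)" and ?nc2.0 = "card (site_box d N)"])
      (auto simp: site_diag_mat_mult_vec schroedinger_mat_def site_mat_mult_vec)
qed

text \<open>An eigenvector splits into a momentum half and a position half, and both are read
  through the same enumeration of the box. From here on only functions on sites occur.\<close>

lemma spectrum_network_mat_iff: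
  "\<mu> \<in> spectrum (network_mat d N m \<xi> \<eta> I \<gamma>) \<longleftrightarrow>
    (\<exists>p q. (\<exists>i\<in>site_box d N. p i \<noteq> 0 \<or> q i \<noteq> 0) \<and>
      (\<forall>i\<in>site_box d N.
        complex_of_real (if i \<in> I then \<gamma> i else 0) * p i - q i / complex_of_real (m i) = \<mu> * p i) \<and>
      (\<forall>i\<in>site_box d N.
        (\<Sum>j\<in>site_box d N. complex_of_real (schroedinger_entry d N \<xi> \<eta> i j) * p j) = \<mu> * q i))"
    (is "_ \<longleftrightarrow> (\<exists>p q. ?nz p q \<and> ?eq1 p q \<and> ?eq2 p q)")
proof -
  let ?M = "network_mat d N m \<xi> \<eta> I \<gamma>" and ?n = "card (site_box d N)"
  have dim: "dim_row ?M = ?n + ?n"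
    by (simp add: network_mat_def site_diag_mat_def site_mat_def)
  have smult: "\<mu> \<cdot>\<^sub>v (site_vec d N p @\<^sub>v site_vec d N q) =
      site_vec d N (\<lambda>i. \<mu> * p i) @\<^sub>v site_vec d N (\<lambda>i. \<mu> * q i)" for p q
    by (intro eq_vecI) (auto simp: site_vec_def)
  have zero: "0\<^sub>v (?n + ?n) = site_vec d N (\<lambda>_. 0) @\<^sub>v site_vec d N (\<lambda>_. 0)"
    by (intro eq_vecI) (auto simp: site_vec_def)
  have ev: "eigenvector ?M (site_vec d N p @\<^sub>v site_vec d N q) \<mu> \<longleftrightarrow> ?nz p q \<and> ?eq1 p q \<and> ?eq2 p q" for p q
    unfolding eigenvector_def dim network_mat_mult_vec smult zero
      append_vec_eq[OF site_vec_carrier site_vec_carrier] site_vec_eq_iff by auto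
  show ?thesis
  proof
    assume "\<mu> \<in> spectrum ?M"
    then obtain x where x: "eigenvector ?M x \<mu>"
      by (auto simp: spectrum_def eigenvalue_def)
    then have "x \<in> carrier_vec (?n + ?n)"
      by (simp add: eigenvector_def dim)
    then have "x = vec_first x ?n @\<^sub>v vec_last x ?n" by simp
    moreover obtain p where "vec_first x ?n = site_vec d N p"
      by (rule site_vec_surj[OF vec_first_carrier])
    moreover obtain q where "vec_last x ?n = site_vec d N q"
      by (rule site_vec_surj[OF vec_last_carrier])
    ultimately have "eigenvector ?M (site_vec d N p @\<^sub>v site_vec d N q) \<mu>"
      using x by simp
    then show "\<exists>p q. ?nz p q \<and> ?eq1 p q \<and> ?eq2 p q"
      unfolding ev by blast
  next
    assume "\<exists>p q. ?nz p q \<and> ?eq1 p q \<and> ?eq2 p q"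
    then show "\<mu> \<in> spectrum ?M"
      unfolding spectrum_def eigenvalue_def using ev by blast
  qed
qed

text \<open>Pairing the first block equation with m p and the second with p gives
  \<open>\<mu>\<close> k = g - w and \<open>\<mu>\<close> w = b, where b is the quadratic form of
  the Schroedinger operator at p. Eliminating w and taking real parts leaves Re \<open>\<mu>\<close>
  (k + b / |\<open>\<mu>\<close>|^2) = g with b and g nonnegative and k positive. The elimination
  divides by \<open>\<mu>\<close>, hence the separate case \<open>\<mu> = 0\<close>.\<close>

lemma Re_spectrum_network_mat_nonneg:
  assumes sym: "\<And>i j. \<xi> i j = \<xi> j i" and \<xi>: "\<And>i j. 0 \<le> \<xi> i j"
    and \<eta>: "\<And>i. i \<in> site_box d N \<Longrightarrow> 0 \<le> \<eta> i"
    and m: "\<And>i. i \<in> site_box d N \<Longrightarrow> 0 < m i"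
    and \<gamma>: "\<And>i. i \<in> I \<Longrightarrow> 0 \<le> \<gamma> i"
    and "\<mu> \<in> spectrum (network_mat d N m \<xi> \<eta> I \<gamma>)"
  shows "0 \<le> Re \<mu>"
proof (cases "\<mu> = 0")
  case False
  let ?B = "site_box d N"
  obtain p q where nz: "\<exists>i\<in>?B. p i \<noteq> 0 \<or> q i \<noteq> 0"
    and eq1: "\<And>i. i \<in> ?B \<Longrightarrow>
        complex_of_real (if i \<in> I then \<gamma> i else 0) * p i - q i / complex_of_real (m i) = \<mu> * p i"
    and eq2: "\<And>i. i \<in> ?B \<Longrightarrow>
        (\<Sum>j\<in>?B. complex_of_real (schroedinger_entry d N \<xi> \<eta> i j) * p j) = \<mu> * q i"
    using assms(6) unfolding spectrum_network_mat_iff by blast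
  define g where "g = (\<Sum>i\<in>?B. m i * (if i \<in> I then \<gamma> i else 0) * (cmod (p i))\<^sup>2)"
  define k where "k = (\<Sum>i\<in>?B. m i * (cmod (p i))\<^sup>2)"
  define w where "w = (\<Sum>i\<in>?B. cnj (p i) * q i)"
  obtain b where b: "0 \<le> b" "\<mu> * w = complex_of_real b"
  proof
    show "0 \<le> 1 / 2 * (\<Sum>i\<in>?B. \<Sum>j | j \<in> ?B \<and> nearest_neighbor d i j. \<xi> i j * (cmod (p i - p j))\<^sup>2)
        + (\<Sum>i\<in>?B. \<eta> i * (cmod (p i))\<^sup>2)"
      using \<xi> \<eta> by (intro add_nonneg_nonneg mult_nonneg_nonneg sum_nonneg) auto
    have "\<mu> * w = (\<Sum>i\<in>?B. cnj (p i) * (\<mu> * q i))"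
      by (simp add: w_def sum_distrib_left mult_ac)
    also have "\<dots> = (\<Sum>i\<in>?B. cnj (p i) * (\<Sum>j\<in>?B. complex_of_real (schroedinger_entry d N \<xi> \<eta> i j) * p j))"
      using eq2 by simp
    also have "\<dots> = (\<Sum>i\<in>?B. \<Sum>j\<in>?B. cnj (p i) * complex_of_real (schroedinger_entry d N \<xi> \<eta> i j) * p j)"
      by (simp add: sum_distrib_left mult.assoc)
    finally show "\<mu> * w = complex_of_real
        (1 / 2 * (\<Sum>i\<in>?B. \<Sum>j | j \<in> ?B \<and> nearest_neighbor d i j. \<xi> i j * (cmod (p i - p j))\<^sup>2)
        + (\<Sum>i\<in>?B. \<eta> i * (cmod (p i))\<^sup>2))"
      unfolding schroedinger_entry_quadratic_form[OF sym] .
  qed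
  have "\<mu> * complex_of_real (m i * (cmod (p i))\<^sup>2) =
      complex_of_real (m i * (if i \<in> I then \<gamma> i else 0) * (cmod (p i))\<^sup>2) - cnj (p i) * q i" if "i \<in> ?B" for i
  proof -
    have "\<mu> * complex_of_real (m i * (cmod (p i))\<^sup>2) = complex_of_real (m i) * cnj (p i) * (\<mu> * p i)"
      by (simp add: complex_norm_square mult_ac del: of_real_power)
    also have "\<dots> = complex_of_real (m i) * cnj (p i) *
        (complex_of_real (if i \<in> I then \<gamma> i else 0) * p i - q i / complex_of_real (m i))"
      by (simp only: eq1[OF that])
    finally show ?thesis
      using m[OF that] by (simp add: complex_norm_square right_diff_distrib mult_ac del: of_real_power)
  qed
  then have "\<mu> * complex_of_real k = complex_of_real g - w"
    by (simp add: k_def g_def w_def sum_distrib_left sum_subtractf)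
  moreover have "w = complex_of_real b / \<mu>"
    using b(2) False by (simp add: field_simps)
  ultimately have "\<mu> * complex_of_real k + complex_of_real b / \<mu> = complex_of_real g"
    by simp
  from arg_cong[OF this, of Re] have "Re \<mu> * k + b * Re \<mu> / (cmod \<mu>)\<^sup>2 = g"
    by (simp add: Re_divide cmod_power2)
  then have main: "Re \<mu> * (k + b / (cmod \<mu>)\<^sup>2) = g"
    by (simp add: algebra_simps)
  \<comment> \<open>If the momentum part vanished, the first block equation would force the position
    part to vanish too; this is what makes \<open>k\<close> positive.\<close>
  have "\<exists>i\<in>?B. p i \<noteq> 0"
  proof (rule ccontr)
    assume "\<not> ?thesis"
    then have "q i = 0" "p i = 0" if "i \<in> ?B" for i
      using eq1[OF that] m[OF that] that by auto
    with nz show False by auto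
  qed
  then obtain i where "i \<in> ?B" "p i \<noteq> 0" by blast
  then have "0 < k"
    unfolding k_def using m by (intro sum_pos2[OF finite_site_box, of i]) (auto simp: less_imp_le)
  moreover have "0 \<le> g"
    unfolding g_def using m \<gamma> by (intro sum_nonneg mult_nonneg_nonneg) (auto intro: less_imp_le)
  ultimately have "0 \<le> Re \<mu> * (k + b / (cmod \<mu>)\<^sup>2)" "0 < k + b / (cmod \<mu>)\<^sup>2"
    using main b(1) by (auto intro: add_pos_nonneg)
  then show ?thesis
    by (simp add: zero_le_mult_iff)
qed simp

section \<open>Degrees and distances in the box\<close>

lemma nearest_neighbor_update:
  assumes i: "i \<in> site_box d N" and j: "j \<in> site_box d N" and nn: "nearest_neighbor d i j"
  shows "\<exists>n<d. j = i(n := i n + 1) \<or> j = i(n := i n - 1)"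
proof -
  let ?D = "\<lambda>n. \<bar>int (i n) - int (j n)\<bar>"
  have sum1: "(\<Sum>n<d. ?D n) = 1"
    using nn by (simp add: nearest_neighbor_def)
  have "\<exists>n<d. ?D n \<noteq> 0"
  proof (rule ccontr)
    assume "\<not> ?thesis"
    then have "(\<Sum>n<d. ?D n) = 0" by (intro sum.neutral) auto
    with sum1 show False by simp
  qed
  then obtain n where n: "n < d" "?D n \<noteq> 0" by blast
  then have "?D n + (\<Sum>k\<in>{..<d} - {n}. ?D k) = 1"
    using sum1 sum.remove[of "{..<d}" n ?D] by simp
  moreover have "0 \<le> (\<Sum>k\<in>{..<d} - {n}. ?D k)"
    by (intro sum_nonneg) auto
  ultimately have "?D n = 1" and rest: "(\<Sum>k\<in>{..<d} - {n}. ?D k) = 0"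
    using n(2) by linarith+
  have eq: "j k = i k" if "k \<noteq> n" for k
  proof (cases "k < d")
    case True
    have "\<forall>k\<in>{..<d} - {n}. ?D k = 0"
      using rest by (subst (asm) sum_nonneg_eq_0_iff) auto
    with True that have "?D k = 0" by blast
    then show ?thesis by linarith
  next
    \<comment> \<open>Coordinates beyond the dimension agree because points of the box are
      extensional functions.\<close>
    case False
    then show ?thesis
      using PiE_arb[OF i[unfolded site_box_def], of k] PiE_arb[OF j[unfolded site_box_def], of k] by simp
  qed
  from \<open>?D n = 1\<close> have "j n = i n + 1 \<or> j n = i n - 1" by linarith
  then have "j = i(n := i n + 1) \<or> j = i(n := i n - 1)"
    using eq by (auto simp: fun_eq_iff)
  then show ?thesis using n(1) by blast
qed

lemma degree_in_site_box_le:
  assumes "i \<in> site_box d N"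
  shows "degree_in (site_box d N) (nearest_neighbor d) i \<le> 2 * real d"
proof -
  let ?up = "\<lambda>n. i(n := i n + 1)" and ?down = "\<lambda>n. i(n := i n - 1)"
  have "{j \<in> site_box d N. nearest_neighbor d i j} \<subseteq> ?up ` {..<d} \<union> ?down ` {..<d}"
    using nearest_neighbor_update[OF assms] by blast
  then have "card {j \<in> site_box d N. nearest_neighbor d i j} \<le> card (?up ` {..<d} \<union> ?down ` {..<d})"
    by (intro card_mono) auto
  also have "\<dots> \<le> card (?up ` {..<d}) + card (?down ` {..<d})"
    by (rule card_Un_le)
  also have "\<dots> \<le> d + d"
    using card_image_le[of "{..<d}" ?up] card_image_le[of "{..<d}" ?down] by simp
  finally show ?thesis by (simp add: degree_in_def)
qed

definition site_dist :: "nat \<Rightarrow> site \<Rightarrow> site \<Rightarrow> nat" where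
  "site_dist d i j = nat (\<Sum>n<d. \<bar>int (i n) - int (j n)\<bar>)"

lemma site_dist_self [simp]: "site_dist d i i = 0"
  by (simp add: site_dist_def)

lemma site_dist_neighbor_le:
  assumes "nearest_neighbor d i j"
  shows "site_dist d i k \<le> Suc (site_dist d j k)"
proof -
  have "(\<Sum>n<d. \<bar>int (i n) - int (k n)\<bar>) \<le> (\<Sum>n<d. \<bar>int (i n) - int (j n)\<bar> + \<bar>int (j n) - int (k n)\<bar>)"
    by (intro sum_mono) linarith
  also have "\<dots> = 1 + (\<Sum>n<d. \<bar>int (j n) - int (k n)\<bar>)"
    using assms by (simp add: nearest_neighbor_def sum.distrib)
  finally show ?thesis
    by (simp add: site_dist_def)
qed

text \<open>One boundary coordinate suffices: the value 1 lies \<open>N div 2 - 1\<close> away from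
  the centre, and the value \<open>N\<close> lies at least as far.\<close>

lemma site_dist_boundary_center_ge:
  assumes "i \<in> site_box_boundary d N"
  shows "N div 2 - 1 \<le> site_dist d i (site_box_center d N)"
proof -
  let ?D = "\<lambda>n. \<bar>int (i n) - int (site_box_center d N n)\<bar>"
  obtain n where n: "n < d" "i n = 1 \<or> i n = N"
    using assms by (auto simp: site_box_boundary_def)
  have "int (N div 2 - 1) \<le> ?D n"
    using n by (auto simp: site_box_center_def)
  also have "?D n \<le> (\<Sum>n<d. ?D n)"
    using n(1) by (intro member_le_sum) auto
  finally show ?thesis
    by (simp add: site_dist_def le_nat_iff)
qed

lemma site_box_center_in:
  assumes "2 \<le> N"
  shows "site_box_center d N \<in> site_box d N"
  using assms by (auto simp: site_box_center_def site_box_def)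

text \<open>For \<open>N\<close> equal to 2 or 3 the coordinates of the centre are 1, so the centre
  is separated from the friction sites only from \<open>N = 4\<close> on.\<close>

lemma center_notin_boundary:
  assumes "4 \<le> N"
  shows "site_box_center d N \<notin> site_box_boundary d N"
  using assms by (auto simp: site_box_center_def site_box_boundary_def)

section \<open>From the localized mode to a bound on the spectral gap\<close>

lemma anchored_graph_site_box:
  assumes "2 \<le> N"
  shows "anchored_graph (site_box d N) (nearest_neighbor d) (site_box_center d N)"
  using finite_site_box site_box_center_in[OF assms] nearest_neighbor_sym not_nearest_neighbor_self
  by unfold_locales auto

lemma schroedinger_row:
  assumes "i \<in> site_box d N"
  shows "(\<Sum>j\<in>site_box d N. complex_of_real (schroedinger_entry d N (\<lambda>_ _. 1) \<eta> i j) * p j) =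
    complex_of_real (degree_in (site_box d N) (nearest_neighbor d) i + \<eta> i) * p i
      - (\<Sum>j | j \<in> site_box d N \<and> nearest_neighbor d i j. p j)"
proof -
  let ?a = "complex_of_real (degree_in (site_box d N) (nearest_neighbor d) i + \<eta> i)"
  have "(\<Sum>j\<in>site_box d N. complex_of_real (schroedinger_entry d N (\<lambda>_ _. 1) \<eta> i j) * p j) =
      (\<Sum>j\<in>site_box d N. (if i = j then ?a * p i else 0) - (if nearest_neighbor d i j then p j else 0))"
    by (intro sum.cong) (auto simp: schroedinger_entry_def degree_in_def not_nearest_neighbor_self)
  also have "\<dots> = ?a * p i - (\<Sum>j | j \<in> site_box d N \<and> nearest_neighbor d i j. p j)"
    using assms finite_site_box by (simp add: sum_subtractf sum.inter_filter)
  finally show ?thesis .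
qed

text \<open>The localized mode provides one eigenvalue with real part at most \<open>K\<close>, and
  all eigenvalues have nonnegative real part, so the infimum lies between 0 and \<open>K\<close>.
  The hypothesis \<open>small\<close> expresses that \<open>N\<close> is large enough for the
  fixed-point argument.\<close>

lemma spectral_gap_bound:
  fixes mass \<epsilon> \<gamma>max :: real
  assumes N: "4 \<le> N" and mass: "mass > 0" and \<epsilon>: "\<epsilon> > 0" and \<gamma>max: "\<gamma>max > 0"
    and \<eta>: "\<And>i. i \<in> site_box d N \<Longrightarrow> \<eta> i > 0"
    and I: "I \<subseteq> site_box_boundary d N"
    and \<gamma>: "\<And>i. i \<in> I \<Longrightarrow> 0 < \<gamma> i" "\<And>i. i \<in> I \<Longrightarrow> \<gamma> i \<le> \<gamma>max"
    and impurity: "\<And>i. i \<in> site_box d N \<Longrightarrow> i \<noteq> site_box_center d N \<Longrightarrow>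
        \<eta> (site_box_center d N) + 2 * real d + \<epsilon> \<le> \<eta> i"
    and K_def: "K = \<gamma>max / 2 * real (N ^ d) * (2 * real d / (2 * real d + \<epsilon> / 2)) ^ (2 * (N div 2 - 1))"
    and small: "K \<le> \<epsilon> / (2 * mass * \<gamma>max)"
  shows "\<bar>spectral_gap d N (\<lambda>_. mass) (\<lambda>_ _. 1) \<eta> I \<gamma>\<bar> \<le> K"
proof -
  let ?S = "site_box d N" and ?c = "site_box_center d N"
  let ?spec = "spectrum (network_mat d N (\<lambda>_. mass) (\<lambda>_ _. 1) \<eta> I \<gamma>)"
  define g where "g i = (if i \<in> I then \<gamma> i else 0)" for i
  interpret anchored_graph ?S "nearest_neighbor d" ?c
    using N by (intro anchored_graph_site_box) simp
  have cI: "?c \<notin> I" using center_notin_boundary[OF N] I by blast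
  have gap: "\<eta> ?c + deg ?c + \<epsilon> \<le> \<eta> i" if "i \<in> ?S - {?c}" for i
    using impurity[of i] degree_in_site_box_le[OF anchor_in] that by auto
  obtain \<mu> v where mode: "v ?c = 1" "0 \<le> Re \<mu>" "Re \<mu> \<le> K"
    and eq: "\<And>i. i \<in> ?S \<Longrightarrow> (of_real mass * \<mu>\<^sup>2 - of_real mass * \<mu> * of_real (g i)
        + of_real (deg i + \<eta> i)) * v i = (\<Sum>j | j \<in> ?S \<and> nearest_neighbor d i j. v j)"
  proof (rule exists_localized_mode[OF mass \<epsilon> \<gamma>max, where \<Delta> = "2 * real d" and \<eta> = \<eta> and g = g
        and f = "\<lambda>i. site_dist d i ?c" and L = "N div 2 - 1" and \<rho> = "2 * real d / (2 * real d + \<epsilon> / 2)"])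
    show "N div 2 - 1 \<le> site_dist d i ?c" if "g i \<noteq> 0" for i
      using that I by (intro site_dist_boundary_center_ge) (auto simp: g_def split: if_splits)
    show "\<gamma>max / 2 * real (card ?S) * (2 * real d / (2 * real d + \<epsilon> / 2)) ^ (2 * (N div 2 - 1))
        \<le> \<epsilon> / (2 * mass * \<gamma>max)"
      using small by (simp add: K_def card_site_box)
    show "0 \<le> g i" "g i \<le> \<gamma>max" for i
      using \<gamma> \<gamma>max by (auto simp: g_def intro: less_imp_le)
  qed (use gap \<eta> anchor_in cI degree_in_site_box_le site_dist_neighbor_le that
      in \<open>auto simp: g_def K_def card_site_box\<close>)
  have "\<mu> \<in> ?spec"
    unfolding spectrum_network_mat_iff
  proof (intro exI conjI ballI)
    \<comment> \<open>The first block equation, solved for the position part when the momentum part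
      is \<open>v\<close>; the second one then becomes the quadratic equation of the mode.\<close>
    let ?q = "\<lambda>i. of_real mass * (of_real (g i) - \<mu>) * v i"
    show "\<exists>i\<in>?S. v i \<noteq> 0 \<or> ?q i \<noteq> 0"
      using mode(1) anchor_in by force
    show "complex_of_real (if i \<in> I then \<gamma> i else 0) * v i - ?q i / complex_of_real mass = \<mu> * v i" for i
      using mass by (simp add: g_def field_simps)
    show "(\<Sum>j\<in>?S. complex_of_real (schroedinger_entry d N (\<lambda>_ _. 1) \<eta> i j) * v j) = \<mu> * ?q i"
      if "i \<in> ?S" for i
      unfolding schroedinger_row[OF that] eq[OF that, symmetric]
      by (simp add: algebra_simps power2_eq_square)
  qed
  moreover have nonneg: "0 \<le> Re \<nu>" if "\<nu> \<in> ?spec" for \<nu>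
    by (rule Re_spectrum_network_mat_nonneg[OF _ _ _ _ _ that]) (use \<eta> mass \<gamma> in \<open>auto intro: less_imp_le\<close>)
  ultimately have "0 \<le> spectral_gap d N (\<lambda>_. mass) (\<lambda>_ _. 1) \<eta> I \<gamma>"
    "spectral_gap d N (\<lambda>_. mass) (\<lambda>_ _. 1) \<eta> I \<gamma> \<le> Re \<mu>"
    unfolding spectral_gap_def
    by (auto intro!: cInf_greatest cInf_lower bdd_belowI[of _ 0])
  then show ?thesis using mode(3) by linarith
qed

section \<open>Exponential decay in the side length\<close>

lemma power_mult_geometric_le_exp:
  fixes \<rho> :: real
  assumes "0 < \<rho>" "\<rho> < 1"
  obtains C b where "C > 0" "b > 0" "\<And>N. real N ^ d * \<rho> ^ N \<le> C * exp (- b * real N)"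
proof -
  \<comment> \<open>Half of the rate of \<open>\<rho> ^ N\<close> is kept, and the other half
    absorbs the polynomial factor.\<close>
  define b where "b = - ln \<rho> / 2"
  have b: "b > 0" using assms by (simp add: b_def)
  have lim: "(\<lambda>N. real N ^ d * exp (- b * real N)) \<longlonglongrightarrow> 0"
  proof -
    have "((\<lambda>x. x ^ d / exp x) \<longlongrightarrow> (0::real)) at_top" by (rule tendsto_power_div_exp_0)
    moreover have "filterlim (\<lambda>N. b * real N) at_top sequentially"
      using b by (intro filterlim_tendsto_pos_mult_at_top[OF tendsto_const] filterlim_real_sequentially)
    ultimately have "(\<lambda>N. (b * real N) ^ d / exp (b * real N)) \<longlonglongrightarrow> 0"
      by (rule filterlim_compose)
    then have "(\<lambda>N. inverse (b ^ d) * ((b * real N) ^ d / exp (b * real N))) \<longlonglongrightarrow> inverse (b ^ d) * 0"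
      by (intro tendsto_intros)
    then show ?thesis
      using b by (simp add: power_mult_distrib exp_minus field_simps)
  qed
  then obtain C where C: "C > 0" "\<And>N. norm (real N ^ d * exp (- b * real N)) \<le> C"
    by (meson convergentI convergent_imp_Bseq BseqE)
  have "real N ^ d * \<rho> ^ N \<le> C * exp (- b * real N)" for N
  proof -
    have "\<rho> ^ N = exp (real N * ln \<rho>)"
      using assms by (simp add: exp_of_nat_mult)
    also have "\<dots> = exp (- b * real N) * exp (- b * real N)"
      by (simp add: b_def exp_add[symmetric])
    finally have "real N ^ d * \<rho> ^ N = real N ^ d * exp (- b * real N) * exp (- b * real N)"
      by simp
    also have "\<dots> \<le> C * exp (- b * real N)"
      using C(2)[of N] by (intro mult_right_mono) auto
    finally show ?thesis .
  qed
  with C(1) b show thesis by (rule that)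
qed

theorem proposition3p6:
  fixes d :: nat
    and mass \<epsilon> \<gamma>max :: real
    and \<eta> \<gamma> :: "nat \<Rightarrow> site \<Rightarrow> real"
    and I :: "nat \<Rightarrow> site set"
  assumes d: "d \<ge> 1"
    and mass: "mass > 0"
    and pinning_pos: "\<And>N i. even N \<Longrightarrow> N > 0 \<Longrightarrow> i \<in> site_box d N \<Longrightarrow> \<eta> N i > 0"
    and friction_boundary: "\<And>N. even N \<Longrightarrow> N > 0 \<Longrightarrow> I N \<subseteq> site_box_boundary d N"
    and friction_nonempty: "\<And>N. even N \<Longrightarrow> N > 0 \<Longrightarrow> I N \<noteq> {}"
    and friction_pos: "\<And>N i. even N \<Longrightarrow> N > 0 \<Longrightarrow> i \<in> I N \<Longrightarrow> \<gamma> N i > 0"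
    and friction_bounded: "\<And>N i. even N \<Longrightarrow> N > 0 \<Longrightarrow> i \<in> I N \<Longrightarrow> \<gamma> N i \<le> \<gamma>max"
    and eps: "\<epsilon> > 0"
    and impurity: "\<And>N i. even N \<Longrightarrow> N > 0 \<Longrightarrow> i \<in> site_box d N \<Longrightarrow> i \<noteq> site_box_center d N \<Longrightarrow>
        \<eta> N (site_box_center d N) + 2 * real d + \<epsilon> \<le> \<eta> N i"
  shows "\<exists>C>0. \<exists>c>0. \<forall>N. even N \<and> N > 0 \<longrightarrow>
      \<bar>spectral_gap d N (\<lambda>_. mass) (\<lambda>_ _. 1) (\<eta> N) (I N) (\<gamma> N)\<bar> \<le> C * exp (- c * real N)"
proof -
  let ?gap = "\<lambda>N. spectral_gap d N (\<lambda>_. mass) (\<lambda>_ _. 1) (\<eta> N) (I N) (\<gamma> N)"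
  define \<rho> where "\<rho> = 2 * real d / (2 * real d + \<epsilon> / 2)"
  define K where "K N = \<gamma>max / 2 * real (N ^ d) * \<rho> ^ (2 * (N div 2 - 1))" for N
  have \<rho>: "0 < \<rho>" "\<rho> < 1"
    using d eps by (auto simp: \<rho>_def divide_simps)
  \<comment> \<open>The box of side 2 already contains a particle with positive friction, and the
    uniform bound dominates that friction.\<close>
  have \<gamma>max: "\<gamma>max > 0"
  proof -
    obtain i where i: "i \<in> I 2" using friction_nonempty[of 2] by auto
    show ?thesis using friction_pos[OF _ _ i] friction_bounded[OF _ _ i] by simp
  qed
  obtain C0 b where C0: "C0 > 0" and b: "b > 0"
    and decay: "\<And>N. real N ^ d * \<rho> ^ N \<le> C0 * exp (- b * real N)"
    using power_mult_geometric_le_exp[OF \<rho>] by blast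
  define C1 where "C1 = \<gamma>max / (2 * \<rho>\<^sup>2) * C0"
  have C1: "C1 > 0" using C0 \<gamma>max \<rho> by (simp add: C1_def)
  have K_le: "K N \<le> C1 * exp (- b * real N)" if "even N" "2 \<le> N" for N
  proof -
    \<comment> \<open>Evenness makes the exponent exactly \<open>N\<close> - 2, so
      \<open>K N\<close> differs from the form N^d \<open>\<rho>\<close>^N only by a constant
      factor.\<close>
    have "2 * (N div 2 - 1) + 2 = N" using that by auto
    then have "\<rho> ^ (2 * (N div 2 - 1)) * \<rho>\<^sup>2 = \<rho> ^ N" by (metis power_add)
    then have "K N = \<gamma>max / (2 * \<rho>\<^sup>2) * (real N ^ d * \<rho> ^ N)"
      using \<rho> by (simp add: K_def field_simps)
    also have "\<dots> \<le> \<gamma>max / (2 * \<rho>\<^sup>2) * (C0 * exp (- b * real N))"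
      using decay \<gamma>max by (intro mult_left_mono) auto
    finally show ?thesis by (simp add: C1_def mult.assoc)
  qed
  have "filterlim (\<lambda>N. b * real N) at_top sequentially"
    using b by (intro filterlim_tendsto_pos_mult_at_top[OF tendsto_const] filterlim_real_sequentially)
  then have "(\<lambda>N. exp (- (b * real N))) \<longlonglongrightarrow> 0"
    by (intro filterlim_compose[OF exp_at_bot] filterlim_compose[OF filterlim_uminus_at_bot_at_top])
  then have "(\<lambda>N. C1 * exp (- b * real N)) \<longlonglongrightarrow> C1 * 0"
    by (intro tendsto_mult_left) simp
  moreover have "C1 * 0 < \<epsilon> / (2 * mass * \<gamma>max)"
    using eps mass \<gamma>max by simp
  ultimately have "\<forall>\<^sub>F N in sequentially. C1 * exp (- b * real N) < \<epsilon> / (2 * mass * \<gamma>max)"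
    by (rule order_tendstoD(2))
  then obtain N1 where N1: "\<And>N. N1 \<le> N \<Longrightarrow> C1 * exp (- b * real N) < \<epsilon> / (2 * mass * \<gamma>max)"
    by (auto simp: eventually_sequentially)
  define N0 where "N0 = max 4 N1"
  have large: "\<bar>?gap N\<bar> \<le> C1 * exp (- b * real N)" if "even N" "N0 \<le> N" for N
  proof -
    have N: "4 \<le> N" "0 < N" "N1 \<le> N" using that by (auto simp: N0_def)
    have "\<bar>?gap N\<bar> \<le> K N"
    proof (rule spectral_gap_bound[OF N(1) mass eps \<gamma>max])
      show "K N = \<gamma>max / 2 * real (N ^ d) * (2 * real d / (2 * real d + \<epsilon> / 2)) ^ (2 * (N div 2 - 1))"
        by (simp add: K_def \<rho>_def)
      show "K N \<le> \<epsilon> / (2 * mass * \<gamma>max)"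
        using K_le[OF that(1)] N1[OF N(3)] N(1) by simp
    qed (fact pinning_pos[OF that(1) N(2)] friction_boundary[OF that(1) N(2)]
        friction_pos[OF that(1) N(2)] friction_bounded[OF that(1) N(2)] impurity[OF that(1) N(2)])+
    also have "\<dots> \<le> C1 * exp (- b * real N)"
      using K_le that(1) N(1) by simp
    finally show ?thesis .
  qed
  define C where "C = C1 + (\<Sum>N<N0. \<bar>?gap N\<bar> * exp (b * real N))"
  have tail: "0 \<le> (\<Sum>N<N0. \<bar>?gap N\<bar> * exp (b * real N))"
    by (intro sum_nonneg) auto
  have "\<bar>?gap N\<bar> \<le> C * exp (- b * real N)" if "even N" for N
  proof (cases "N0 \<le> N")
    case True
    have "C1 * exp (- b * real N) \<le> C * exp (- b * real N)"
      using tail by (intro mult_right_mono) (auto simp: C_def)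
    with large[OF that True] show ?thesis by linarith
  next
    case False
    then have "\<bar>?gap N\<bar> * exp (b * real N) \<le> (\<Sum>N<N0. \<bar>?gap N\<bar> * exp (b * real N))"
      by (intro member_le_sum) auto
    then have "\<bar>?gap N\<bar> * exp (b * real N) \<le> C"
      using C1 by (simp add: C_def)
    then show ?thesis by (simp add: exp_minus field_simps)
  qed
  moreover have "C > 0" using C1 tail by (simp add: C_def)
  ultimately show ?thesis using b by blast
qed

end
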